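(* Let $\mathbb{G}$ be a stratified Lie group of step $s$, let $\theta\in[1,\infty]$, and let $\mathbf b=\sum_{i=1}^s\sum_{\alpha=1}^{n_i}b^i_\alpha X^i_\alpha$ be a vector field such that $b^i_\alpha\in W^{1,\theta}_{\mathcal H,\mathrm{loc}}(\mathbb G)$ for all $i,\alpha$ and $[\mathbf b,V_1]_p\subseteq\mathcal H_p$ for a.e. $p\in\mathbb G$. Then, for every $i=1,\dots,s$, $$b^i_\alpha\in W^{i,\theta}_{\mathcal H,\mathrm{loc}}(\mathbb G)\qquad\text{for every }\alpha=1,\dots,n_i.$$
   Context: $\mathbb{G}$ is a connected, simply connected Lie group whose Lie algebra $\mathfrak g$ of left-invariant vector fields has a stratification $\mathfrak g=V_1\oplus\dots\oplus V_s$ with nontrivial $V_i$, $V_{i+1}=[V_1,V_i]$ for $i=1,\dots,s-1$, and $[V_1,V_s]=\{0\}$. Put $n_i=\dim V_i$ and fix a basis $X^i_1,\dots,X^i_{n_i}$ of $V_i$ for each $i$. $\mathbb G$ is identified with $\mathbb R^n$ through graded exponential coordinates; the Haar measure $dp$ is Lebesgue measure. The horizontal distribution is $\mathcal H_p=V_1(p)$. Weak derivatives are given by $\langle X^i_\alpha u,\varphi\rangle=-\int uX^i_\alpha\varphi\,dp$, $\varphi\in C_c^\infty$. For $\ell\ge1$, $W^{\ell,\theta}_{\mathcal H}(\Omega)$ is the set of $u\in L^\theta(\Omega)$ such that $X^1_{\alpha_1}\cdots X^1_{\alpha_k}u\in L^\theta(\Omega)$ for all $k=1,\dots,\ell$ and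 $\alpha_1,\dots,\alpha_k\in\{1,\dots,n_1\}$; $\mathrm{loc}$ denotes the local version. The condition $[\mathbf b,V_1]_p\subseteq\mathcal H_p$ for a.e. $p$ means that for every $Z\in V_1$ one has $[\mathbf b,Z]_p\in\mathcal H_p$ for a.e. $p$, where $[\mathbf b,Z]=\sum_{i,\alpha}b^i_\alpha[X^i_\alpha,Z]-\sum_{i,\alpha}(Zb^i_\alpha)X^i_\alpha$ with $Zb^i_\alpha$ the weak derivative. *)

theory Defs
  imports "HOL-Analysis.Analysis" "HOL-Library.Function_Algebras"
begin

text \<open>Vector fields on a Euclidean space are functions from the space to itself; they form a real
  vector space under the pointwise operations, so that \<^const>\<open>span\<close>, \<^const>\<open>dim\<close>, etc. apply to
  sets of vector fields.\<close>

instantiation "fun" :: (type, real_vector) real_vector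
begin

definition scaleR_fun :: "real \<Rightarrow> ('a \<Rightarrow> 'b) \<Rightarrow> 'a \<Rightarrow> 'b"
  where "scaleR_fun r f = (\<lambda>x. r *\<^sub>R f x)"

instance
  by standard (simp_all add: scaleR_fun_def fun_eq_iff algebra_simps)

end


section \<open>Smooth functions and vector fields\<close>

text \<open>Class \<open>C\<^sup>k\<close> on the whole space: for \<open>k > 0\<close>, differentiable with all directional
  derivatives of class \<open>C\<^sup>k\<^sup>-\<^sup>1\<close>.\<close>

primrec C_diff :: "nat \<Rightarrow> ('a::euclidean_space \<Rightarrow> 'b::real_normed_vector) \<Rightarrow> bool" where
  "C_diff 0 f \<longleftrightarrow> continuous_on UNIV f"
| "C_diff (Suc k) f \<longleftrightarrow>
     (\<forall>x. f differentiable (at x)) \<and> (\<forall>v. C_diff k (\<lambda>x. frechet_derivative f (at x) v))"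

definition smooth :: "('a::euclidean_space \<Rightarrow> 'b::real_normed_vector) \<Rightarrow> bool"
  where "smooth f \<longleftrightarrow> (\<forall>k. C_diff k f)"

definition field_apply :: "('a::euclidean_space \<Rightarrow> 'a) \<Rightarrow> ('a \<Rightarrow> real) \<Rightarrow> 'a \<Rightarrow> real"
  where "field_apply X f = (\<lambda>p. frechet_derivative f (at p) (X p))"

text \<open>The sign is such that \<open>[X,Y] f = X (Y f) - Y (X f)\<close>.\<close>

definition lie_bracket :: "('a::euclidean_space \<Rightarrow> 'a) \<Rightarrow> ('a \<Rightarrow> 'a) \<Rightarrow> 'a \<Rightarrow> 'a"
  where "lie_bracket X Y =
    (\<lambda>p. frechet_derivative Y (at p) (X p) - frechet_derivative X (at p) (Y p))"

definition integral_curve :: "('a::euclidean_space \<Rightarrow> 'a) \<Rightarrow> (real \<Rightarrow> 'a) \<Rightarrow> bool"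
  where "integral_curve X \<gamma> \<longleftrightarrow> (\<forall>t. (\<gamma> has_vector_derivative X (\<gamma> t)) (at t))"


section \<open>Stratified groups in graded exponential coordinates\<close>

text \<open>The left-invariant vector fields of the Lie group with multiplication \<open>mul\<close>.\<close>

definition lie_algebra :: "('a::euclidean_space \<Rightarrow> 'a \<Rightarrow> 'a) \<Rightarrow> ('a \<Rightarrow> 'a) set"
  where "lie_algebra mul =
    {X. smooth X \<and> (\<forall>p q. frechet_derivative (mul p) (at q) (X q) = X (mul p q))}"

text \<open>The Lie group exponential, as the time-one value of the integral curve through the identity,
  which is \<open>0\<close>. It is meaningful for left-invariant \<open>X\<close>: these are smooth and complete, so the
  curve exists and is unique.\<close>

definition lie_exp :: "('a::euclidean_space \<Rightarrow> 'a) \<Rightarrow> 'a"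
  where "lie_exp X = (THE p. \<exists>\<gamma>. integral_curve X \<gamma> \<and> \<gamma> 0 = 0 \<and> \<gamma> 1 = p)"

text \<open>A Lie group whose underlying manifold is the whole Euclidean space (hence connected and simply
  connected), with identity \<open>0\<close> and a stratification \<open>V 1, \<dots>, V s\<close> of its Lie algebra. Bijectivity
  of the summation map says that the Lie algebra is the direct sum of the layers.\<close>

locale stratified_group = group mul 0 ginv
  for mul :: "'a::euclidean_space \<Rightarrow> 'a \<Rightarrow> 'a" and ginv :: "'a \<Rightarrow> 'a" +
  fixes s :: nat and V :: "nat \<Rightarrow> ('a \<Rightarrow> 'a) set"
  assumes smooth_mul: "smooth (\<lambda>(p, q). mul p q)"
    and smooth_inv: "smooth ginv"
    and step_pos: "1 \<le> s"
    and subspace_layer: "i \<in> {1..s} \<Longrightarrow> subspace (V i)"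
    and nontrivial_layer: "i \<in> {1..s} \<Longrightarrow> V i \<noteq> {0}"
    and direct_sum: "bij_betw (\<lambda>Y. \<Sum>i=1..s. Y i) (\<Pi>\<^sub>E i\<in>{1..s}. V i) (lie_algebra mul)"
    and bracket_layer:
      "i \<in> {1..<s} \<Longrightarrow> V (Suc i) = span {lie_bracket Y Z | Y Z. Y \<in> V 1 \<and> Z \<in> V i}"
    and bracket_top: "Y \<in> V 1 \<Longrightarrow> Z \<in> V s \<Longrightarrow> lie_bracket Y Z = 0"

text \<open>\<open>X i 1, \<dots>, X i n\<^sub>i\<close> is a basis of \<open>V i\<close>, where \<open>n\<^sub>i = dim (V i)\<close>, and the point with coordinates
  \<open>x i \<alpha>\<close> is \<open>exp (\<Sum> x i \<alpha> X i \<alpha>)\<close>. The standard basis of the Euclidean space is enumerated by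
  \<open>E i \<alpha>\<close>, so \<open>x \<bullet> E i \<alpha>\<close> are the coordinates of \<open>x\<close>. In these coordinates the Haar measure
  is \<^const>\<open>lebesgue\<close>.\<close>

locale graded_coordinates = stratified_group mul ginv s V
  for mul :: "'a::euclidean_space \<Rightarrow> 'a \<Rightarrow> 'a" and ginv s V +
  fixes X :: "nat \<Rightarrow> nat \<Rightarrow> 'a \<Rightarrow> 'a" and E :: "nat \<Rightarrow> nat \<Rightarrow> 'a"
  assumes frame_inj: "i \<in> {1..s} \<Longrightarrow> inj_on (X i) {1..dim (V i)}"
    and frame_independent: "i \<in> {1..s} \<Longrightarrow> independent (X i ` {1..dim (V i)})"
    and frame_span: "i \<in> {1..s} \<Longrightarrow> span (X i ` {1..dim (V i)}) = V i"
    and coordinate_axes: "bij_betw (\<lambda>(i, \<alpha>). E i \<alpha>) (SIGMA i:{1..s}. {1..dim (V i)}) Basis"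
    and exponential_coordinates:
      "lie_exp (\<Sum>i=1..s. \<Sum>\<alpha>=1..dim (V i). (x \<bullet> E i \<alpha>) *\<^sub>R X i \<alpha>) = x"

definition horizontal :: "(nat \<Rightarrow> ('a \<Rightarrow> 'a) set) \<Rightarrow> 'a \<Rightarrow> 'a set"
  where "horizontal V p = (\<lambda>Y. Y p) ` V 1"


section \<open>Distributional derivatives and horizontal Sobolev spaces\<close>

definition test_function :: "'a::euclidean_space set \<Rightarrow> ('a \<Rightarrow> real) \<Rightarrow> bool"
  where "test_function \<Omega> \<phi> \<longleftrightarrow>
    smooth \<phi> \<and> compact (closure {x. \<phi> x \<noteq> 0}) \<and> closure {x. \<phi> x \<noteq> 0} \<subseteq> \<Omega>"

definition dist_of :: "'a::euclidean_space set \<Rightarrow> ('a \<Rightarrow> real) \<Rightarrow> ('a \<Rightarrow> real) \<Rightarrow> real"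
  where "dist_of \<Omega> u = (\<lambda>\<phi>. LINT x|lebesgue_on \<Omega>. u x * \<phi> x)"

definition dist_deriv ::
    "('a::euclidean_space \<Rightarrow> 'a) \<Rightarrow> (('a \<Rightarrow> real) \<Rightarrow> real) \<Rightarrow> ('a \<Rightarrow> real) \<Rightarrow> real"
  where "dist_deriv X T = (\<lambda>\<phi>. - T (field_apply X \<phi>))"

definition dist_eq ::
    "'a::euclidean_space set \<Rightarrow> (('a \<Rightarrow> real) \<Rightarrow> real) \<Rightarrow> (('a \<Rightarrow> real) \<Rightarrow> real) \<Rightarrow> bool"
  where "dist_eq \<Omega> T S \<longleftrightarrow> (\<forall>\<phi>. test_function \<Omega> \<phi> \<longrightarrow> T \<phi> = S \<phi>)"

definition Lebesgue_space :: "ennreal \<Rightarrow> 'a::euclidean_space set \<Rightarrow> ('a \<Rightarrow> real) set"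
  where "Lebesgue_space \<theta> \<Omega> = {u \<in> borel_measurable (lebesgue_on \<Omega>).
    if \<theta> = \<infinity> then \<exists>C. AE x in lebesgue_on \<Omega>. \<bar>u x\<bar> \<le> C
    else integrable (lebesgue_on \<Omega>) (\<lambda>x. \<bar>u x\<bar> powr enn2real \<theta>)}"

text \<open>\<open>loc F \<Omega>\<close> is the local version on \<open>\<Omega>\<close> of a family \<open>F\<close> of function spaces indexed by open sets.\<close>

definition loc :: "('a::euclidean_space set \<Rightarrow> ('a \<Rightarrow> real) set) \<Rightarrow> 'a set \<Rightarrow> ('a \<Rightarrow> real) set"
  where "loc F \<Omega> =
    {u. \<forall>U. open U \<and> compact (closure U) \<and> closure U \<subseteq> \<Omega> \<longrightarrow> u \<in> F U}"

definition weak_deriv ::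
    "'a::euclidean_space set \<Rightarrow> ('a \<Rightarrow> 'a) \<Rightarrow> ('a \<Rightarrow> real) \<Rightarrow> ('a \<Rightarrow> real) \<Rightarrow> bool"
  where "weak_deriv \<Omega> X u w \<longleftrightarrow>
    w \<in> loc (Lebesgue_space 1) \<Omega> \<and> dist_eq \<Omega> (dist_deriv X (dist_of \<Omega> u)) (dist_of \<Omega> w)"

text \<open>\<open>Y 1, \<dots>, Y m\<close> is the horizontal frame. The list \<open>[\<alpha>\<^sub>1, \<dots>, \<alpha>\<^sub>k]\<close> stands for the distribution
  \<open>Y \<alpha>\<^sub>1 (\<dots> (Y \<alpha>\<^sub>k u))\<close>, which must be represented by a function in \<open>L\<^sup>\<theta>\<close>.\<close>

definition Sobolev ::
    "(nat \<Rightarrow> 'a::euclidean_space \<Rightarrow> 'a) \<Rightarrow> nat \<Rightarrow> nat \<Rightarrow> ennreal \<Rightarrow> 'a set \<Rightarrow> ('a \<Rightarrow> real) set"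
  where "Sobolev Y m l \<theta> \<Omega> = {u \<in> Lebesgue_space \<theta> \<Omega>.
    \<forall>\<alpha>s. 1 \<le> length \<alpha>s \<and> length \<alpha>s \<le> l \<and> set \<alpha>s \<subseteq> {1..m} \<longrightarrow>
      (\<exists>w \<in> Lebesgue_space \<theta> \<Omega>.
        dist_eq \<Omega> (foldr (\<lambda>\<alpha>. dist_deriv (Y \<alpha>)) \<alpha>s (dist_of \<Omega> u)) (dist_of \<Omega> w))}"


section \<open>Vector fields with weakly differentiable coefficients\<close>

text \<open>\<open>[b, V\<^sub>1]\<^sub>p \<subseteq> H\<^sub>p\<close> for a.e. \<open>p\<close>, for \<open>b = \<Sum> b i \<alpha> X i \<alpha>\<close>; the function \<open>w i \<alpha>\<close> is the
  weak derivative \<open>Z (b i \<alpha>)\<close>, which is determined up to null sets.\<close>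

definition bracket_horizontal ::
    "nat \<Rightarrow> (nat \<Rightarrow> ('a::euclidean_space \<Rightarrow> 'a) set) \<Rightarrow> (nat \<Rightarrow> nat \<Rightarrow> 'a \<Rightarrow> 'a) \<Rightarrow>
      (nat \<Rightarrow> nat \<Rightarrow> 'a \<Rightarrow> real) \<Rightarrow> bool"
  where "bracket_horizontal s V X b \<longleftrightarrow>
    (\<forall>Z \<in> V 1. \<exists>w.
      (\<forall>i\<in>{1..s}. \<forall>\<alpha>\<in>{1..dim (V i)}. weak_deriv UNIV Z (b i \<alpha>) (w i \<alpha>)) \<and>
      (AE p in lebesgue.
        (\<Sum>i=1..s. \<Sum>\<alpha>=1..dim (V i). b i \<alpha> p *\<^sub>R lie_bracket (X i \<alpha>) Z p)
        - (\<Sum>i=1..s. \<Sum>\<alpha>=1..dim (V i). w i \<alpha> p *\<^sub>R X i \<alpha> p) \<in> horizontal V p))"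

end

theory Submission
  imports Defs
begin

text \<open>
  Let \<open>Z\<close> be a horizontal left-invariant field. The bracket \<open>[b, Z]\<close> is
  \<open>\<Sum> b i \<alpha> [X i \<alpha>, Z] - \<Sum> (Z (b i \<alpha>)) X i \<alpha>\<close>, and \<open>[X i \<alpha>, Z]\<close> lies in layer \<open>i + 1\<close>, so it
  is a combination of the fields \<open>X (i + 1) \<gamma>\<close> with \<^emph>\<open>constant\<close> coefficients \<open>c \<alpha> \<gamma>\<close>. At almost
  every point the bracket is horizontal, and the layers are independent at every point; comparing
  the components along \<open>X (i + 1) \<gamma>\<close> therefore gives
  \<open>Z (b (i + 1) \<gamma>) = \<Sum>\<alpha>. c \<alpha> \<gamma> * b i \<alpha>\<close> almost everywhere
  (\<open>horizontal_derivative_lincomb\<close>). Hence every first horizontal derivative of a coefficient in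
  layer \<open>i + 1\<close> is as regular as the coefficients in layer \<open>i\<close>, and each layer gains one derivative
  by induction on \<open>i\<close>.

  Two ingredients make this precise. Pointwise independence holds because a left-invariant field
  that vanishes at one point vanishes identically (\<open>left_invariant_eq_zero\<close>), so that independence
  in the Lie algebra passes to every tangent space. On the analytic side, on a bounded open set the
  Sobolev space of order \<open>l\<close> is closed under linear combinations (\<open>Sobolev_lincomb\<close>), and a function
  whose first derivatives are in it is in the space of order \<open>l + 1\<close> (\<open>Sobolev_SucI\<close>). Both
  statements transport iterated distributional derivatives to the test function, which needs
  that the derivative of a test function along a smooth field is again a test function.
\<close>

section \<open>Calculus of smooth functions\<close>

lemma frechet_derivative_eqI:
  "(f has_derivative D) (at x) \<Longrightarrow> frechet_derivative f (at x) v = D v"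
  by (simp add: frechet_derivative_at[symmetric])

text \<open>The product rule for \<^const>\<open>C_diff\<close> has undifferentiated factors in it, so its induction has
  to lower the order of each factor.\<close>

lemma C_diff_Suc_imp:
  fixes f :: "'a::euclidean_space \<Rightarrow> 'b::real_normed_vector"
  shows "C_diff (Suc k) f \<Longrightarrow> C_diff k f"
proof (induction k arbitrary: f)
  case 0
  then show ?case
    by (auto intro!: differentiable_imp_continuous_on simp: differentiable_on_def
        intro: differentiable_at_withinI)
next
  case (Suc k)
  have "C_diff k (\<lambda>x. frechet_derivative f (at x) v)" for v
    using Suc.prems by (intro Suc.IH) simp
  then show ?case
    using Suc.prems by simp
qed

lemma C_diff_zero: "C_diff k (\<lambda>x. 0)"
  by (induction k) simp_all

lemma C_diff_add:
  fixes f g :: "'a::euclidean_space \<Rightarrow> 'b::real_normed_vector"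
  shows "C_diff k f \<Longrightarrow> C_diff k g \<Longrightarrow> C_diff k (\<lambda>x. f x + g x)"
proof (induction k arbitrary: f g)
  case 0
  then show ?case by (auto intro: continuous_intros)
next
  case (Suc k)
  have f: "f differentiable (at x)" and g: "g differentiable (at x)" for x
    using Suc.prems by auto
  have "(\<lambda>x. frechet_derivative (\<lambda>x. f x + g x) (at x) v) =
      (\<lambda>x. frechet_derivative f (at x) v + frechet_derivative g (at x) v)" for v
    using f g by (auto simp: frechet_derivative_works intro!: frechet_derivative_eqI has_derivative_add)
  then show ?case
    using Suc f g by simp
qed

lemma C_diff_sum:
  fixes f :: "'i \<Rightarrow> 'a::euclidean_space \<Rightarrow> 'b::real_normed_vector"
  assumes "\<And>i. i \<in> I \<Longrightarrow> C_diff k (f i)"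
  shows "C_diff k (\<lambda>x. \<Sum>i\<in>I. f i x)"
  using assms
  by (induction I rule: infinite_finite_induct) (simp_all add: C_diff_zero C_diff_add)

lemma C_diff_mult:
  fixes f g :: "'a::euclidean_space \<Rightarrow> real"
  shows "C_diff k f \<Longrightarrow> C_diff k g \<Longrightarrow> C_diff k (\<lambda>x. f x * g x)"
proof (induction k arbitrary: f g)
  case 0
  then show ?case by (auto intro: continuous_intros)
next
  case (Suc k)
  have f: "f differentiable (at x)" and g: "g differentiable (at x)" for x
    using Suc.prems by auto
  have D: "((\<lambda>x. f x * g x) has_derivative
      (\<lambda>v. f x * frechet_derivative g (at x) v + frechet_derivative f (at x) v * g x)) (at x)" for x
    using has_derivative_mult f g frechet_derivative_works by blast
  then have "(\<lambda>x. frechet_derivative (\<lambda>x. f x * g x) (at x) v) =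
      (\<lambda>x. f x * frechet_derivative g (at x) v + frechet_derivative f (at x) v * g x)" for v
    using frechet_derivative_eqI by (intro ext) blast
  moreover have "C_diff k f" "C_diff k g"
    using Suc.prems C_diff_Suc_imp by blast+
  moreover have "(\<lambda>x. f x * g x) differentiable (at x)" for x
    using D differentiable_def by blast
  ultimately show ?case
    using Suc.prems Suc.IH by (auto intro: C_diff_add)
qed

lemma C_diff_inner_left:
  fixes f :: "'a::euclidean_space \<Rightarrow> 'b::real_inner"
  shows "C_diff k f \<Longrightarrow> C_diff k (\<lambda>x. f x \<bullet> e)"
proof (induction k arbitrary: f)
  case 0
  then show ?case by (auto intro: continuous_intros)
next
  case (Suc k)
  have D: "((\<lambda>x. f x \<bullet> e) has_derivative (\<lambda>v. frechet_derivative f (at x) v \<bullet> e)) (at x)" for x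
    using Suc.prems by (intro has_derivative_inner_left) (simp add: frechet_derivative_works[symmetric])
  then have "(\<lambda>x. frechet_derivative (\<lambda>x. f x \<bullet> e) (at x) v) =
      (\<lambda>x. frechet_derivative f (at x) v \<bullet> e)" for v
    using frechet_derivative_eqI by (intro ext) blast
  moreover have "(\<lambda>x. f x \<bullet> e) differentiable (at x)" for x
    using D differentiable_def by blast
  ultimately show ?case
    using Suc by simp
qed

lemma smooth_differentiable: "smooth f \<Longrightarrow> f differentiable (at x)"
  unfolding smooth_def by (metis C_diff.simps(2))

lemma smooth_continuous: "smooth f \<Longrightarrow> continuous_on UNIV f"
  unfolding smooth_def by (metis C_diff.simps(1))

text \<open>In coordinates \<open>X f\<close> is the sum of the products of the components of \<open>X\<close> with the partial
  derivatives of \<open>f\<close>, which reduces the claim to sums and products of real functions.\<close>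

lemma smooth_field_apply:
  fixes f :: "'a::euclidean_space \<Rightarrow> real"
  assumes X: "smooth X" and f: "smooth f"
  shows "smooth (field_apply X f)"
proof -
  have "field_apply X f = (\<lambda>p. \<Sum>e\<in>Basis. (X p \<bullet> e) * frechet_derivative f (at p) e)"
  proof
    fix p
    have lin: "linear (frechet_derivative f (at p))"
      by (simp add: f linear_frechet_derivative smooth_differentiable)
    have "frechet_derivative f (at p) (\<Sum>e\<in>Basis. (X p \<bullet> e) *\<^sub>R e) =
        (\<Sum>e\<in>Basis. (X p \<bullet> e) * frechet_derivative f (at p) e)"
      by (simp add: linear_sum[OF lin] linear_scale[OF lin])
    then show "field_apply X f p = (\<Sum>e\<in>Basis. (X p \<bullet> e) * frechet_derivative f (at p) e)"
      by (simp add: field_apply_def euclidean_representation)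
  qed
  moreover have "C_diff k (\<lambda>p. frechet_derivative f (at p) e)" for k e
    using f C_diff.simps(2)[of k f] unfolding smooth_def by blast
  moreover have "C_diff k X" for k
    using X by (simp add: smooth_def)
  ultimately show ?thesis
    unfolding smooth_def by (simp add: C_diff_sum C_diff_mult C_diff_inner_left)
qed

section \<open>Test functions and iterated distributional derivatives\<close>

lemma zero_outside_support: "x \<notin> closure {x. f x \<noteq> 0} \<Longrightarrow> f x = 0"
  using closure_subset[of "{x. f x \<noteq> 0}"] by auto

text \<open>Off the support of \<open>\<phi>\<close> the function vanishes near each point, hence so does its derivative: the
  support does not grow.\<close>

lemma test_function_field_apply:
  assumes X: "smooth X" and \<phi>: "test_function U \<phi>"
  shows "test_function U (field_apply X \<phi>)"
proof -
  let ?K = "closure {x. \<phi> x \<noteq> 0}"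
  have "field_apply X \<phi> p = 0" if p: "p \<notin> ?K" for p
  proof -
    have zero: "0 = \<phi> x" if "x \<in> - ?K" for x
      using that zero_outside_support[of x \<phi>] by simp
    have "(\<phi> has_derivative (\<lambda>v. 0)) (at p)"
      by (rule has_derivative_transform_within_open[OF has_derivative_const, where s = "- ?K"])
        (use p zero in \<open>simp_all only: open_Compl closed_closure Compl_iff simp_thms\<close>)
    then show ?thesis
      unfolding field_apply_def by (rule frechet_derivative_eqI)
  qed
  then have "closure {x. field_apply X \<phi> x \<noteq> 0} \<subseteq> ?K"
    by (intro closure_minimal) auto
  moreover from this have "compact (closure {x. field_apply X \<phi> x \<noteq> 0})"
    using compact_Int_closed[of ?K "closure {x. field_apply X \<phi> x \<noteq> 0}"] \<phi>
    by (simp add: test_function_def Int_absorb1)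
  moreover have "smooth (field_apply X \<phi>)"
    using X \<phi> by (simp add: smooth_field_apply test_function_def)
  ultimately show ?thesis
    using \<phi> by (auto simp add: test_function_def)
qed

lemma test_function_fold:
  assumes "\<And>a. a \<in> set as \<Longrightarrow> smooth (Y a)" and "test_function U \<phi>"
  shows "test_function U (fold (\<lambda>a. field_apply (Y a)) as \<phi>)"
  using assms by (induction as arbitrary: \<phi>) (auto simp: test_function_field_apply)

text \<open>The outermost distributional derivative acts on the test function first: this is why \<^const>\<open>foldr\<close>
  on the left becomes \<^const>\<open>fold\<close> on the right.\<close>

lemma foldr_dist_deriv:
  "foldr (\<lambda>a. dist_deriv (Y a)) as T \<phi> =
    (- 1) ^ length as * T (fold (\<lambda>a. field_apply (Y a)) as \<phi>)"
  by (induction as arbitrary: \<phi>) (simp_all add: dist_deriv_def)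

lemma test_function_zero_outside: "test_function U \<phi> \<Longrightarrow> x \<notin> U \<Longrightarrow> \<phi> x = 0"
  unfolding test_function_def using zero_outside_support[of x \<phi>] by auto

lemma test_function_mono: "test_function U \<phi> \<Longrightarrow> U \<subseteq> W \<Longrightarrow> test_function W \<phi>"
  unfolding test_function_def by blast

lemma test_function_bounded:
  assumes "test_function U \<phi>"
  obtains B where "\<And>x. \<bar>\<phi> x\<bar> \<le> B"
proof -
  let ?K = "closure {x. \<phi> x \<noteq> 0}"
  have "compact (\<phi> ` ?K)"
    using assms unfolding test_function_def
    by (intro compact_continuous_image continuous_on_subset[OF smooth_continuous]) auto
  then obtain B where B: "\<And>x. x \<in> ?K \<Longrightarrow> \<bar>\<phi> x\<bar> \<le> B"
    by (fastforce dest!: compact_imp_bounded simp: bounded_iff)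
  have "\<bar>\<phi> x\<bar> \<le> max B 0" for x
    using B[of x] zero_outside_support[of x \<phi>] by (cases "x \<in> ?K") auto
  then show ?thesis by (rule that)
qed

lemma dist_of_restrict:
  assumes U: "open U" and \<phi>: "test_function U \<phi>"
  shows "dist_of UNIV u \<phi> = dist_of U u \<phi>"
proof -
  have "dist_of U u \<phi> = (LINT x|lebesgue. indicat_real U x *\<^sub>R (u x * \<phi> x))"
    unfolding dist_of_def using U by (subst integral_restrict_space) auto
  also have "\<dots> = (LINT x|lebesgue. u x * \<phi> x)"
    by (intro Bochner_Integration.integral_cong)
      (auto simp: indicator_def test_function_zero_outside[OF \<phi>])
  finally show ?thesis
    by (simp add: dist_of_def lebesgue_on_UNIV_eq)
qed

section \<open>Horizontal Sobolev spaces on bounded open sets\<close>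

text \<open>For finite exponents the integrability of a sum rests on
  \<open>\<bar>y + z\<bar> \<le> max (2 * \<bar>y\<bar>) (2 * \<bar>z\<bar>)\<close>, whose power is at most the sum of the powers of the
  two entries.\<close>

lemma Lebesgue_space_lincomb:
  assumes "1 \<le> \<theta>" and "finite A" and "\<And>a. a \<in> A \<Longrightarrow> v a \<in> Lebesgue_space \<theta> U"
  shows "(\<lambda>x. \<Sum>a\<in>A. c a * v a x) \<in> Lebesgue_space \<theta> U"
  using assms(2,3)
proof (induction A rule: finite_induct)
  case empty
  then show ?case using assms(1) by (auto simp: Lebesgue_space_def)
next
  case (insert a A)
  let ?f = "v a" and ?g = "\<lambda>x. \<Sum>a\<in>A. c a * v a x"
  have f: "?f \<in> Lebesgue_space \<theta> U" and g: "?g \<in> Lebesgue_space \<theta> U"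
    using insert by auto
  have meas [measurable]: "?f \<in> borel_measurable (lebesgue_on U)" "?g \<in> borel_measurable (lebesgue_on U)"
    using f g by (auto simp: Lebesgue_space_def)
  have "(\<lambda>x. c a * ?f x + ?g x) \<in> Lebesgue_space \<theta> U"
  proof (cases "\<theta> = \<infinity>")
    case True
    obtain B C where "AE x in lebesgue_on U. \<bar>?f x\<bar> \<le> B" "AE x in lebesgue_on U. \<bar>?g x\<bar> \<le> C"
      using f g True by (auto simp: Lebesgue_space_def)
    then have "AE x in lebesgue_on U. \<bar>c a * ?f x + ?g x\<bar> \<le> \<bar>c a\<bar> * B + C"
    proof eventually_elim
      case (elim x)
      have "\<bar>c a * ?f x + ?g x\<bar> \<le> \<bar>c a\<bar> * \<bar>?f x\<bar> + \<bar>?g x\<bar>"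
        using abs_triangle_ineq[of "c a * ?f x" "?g x"] by (simp only: abs_mult)
      also have "\<dots> \<le> \<bar>c a\<bar> * B + C"
        using elim by (intro add_mono mult_left_mono) auto
      finally show ?case .
    qed
    then show ?thesis using True by (auto simp: Lebesgue_space_def)
  next
    case False
    define r where "r = enn2real \<theta>"
    have "0 \<le> r" by (simp add: r_def)
    have int: "integrable (lebesgue_on U) (\<lambda>x. \<bar>?f x\<bar> powr r)"
        "integrable (lebesgue_on U) (\<lambda>x. \<bar>?g x\<bar> powr r)"
      using f g False by (auto simp: Lebesgue_space_def r_def)
    have bound: "\<bar>c a * y + z\<bar> powr r \<le>
        (2 * \<bar>c a\<bar>) powr r * \<bar>y\<bar> powr r + 2 powr r * \<bar>z\<bar> powr r" for y z
    proof -
      have "\<bar>c a * y + z\<bar> \<le> max (2 * \<bar>c a\<bar> * \<bar>y\<bar>) (2 * \<bar>z\<bar>)"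
        using abs_triangle_ineq[of "c a * y" z] by (simp add: abs_mult)
      then have "\<bar>c a * y + z\<bar> powr r \<le> max (2 * \<bar>c a\<bar> * \<bar>y\<bar>) (2 * \<bar>z\<bar>) powr r"
        using \<open>0 \<le> r\<close> by (intro powr_mono2) auto
      also have "\<dots> \<le> (2 * \<bar>c a\<bar> * \<bar>y\<bar>) powr r + (2 * \<bar>z\<bar>) powr r"
        by (auto simp: max_def)
      finally show ?thesis by (simp add: powr_mult)
    qed
    have "integrable (lebesgue_on U) (\<lambda>x. \<bar>c a * ?f x + ?g x\<bar> powr r)"
      by (rule Bochner_Integration.integrable_bound[where
            f = "\<lambda>x. (2 * \<bar>c a\<bar>) powr r * \<bar>?f x\<bar> powr r + 2 powr r * \<bar>?g x\<bar> powr r"])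
        (use int bound in auto)
    then show ?thesis using False by (auto simp: Lebesgue_space_def r_def)
  qed
  then show ?case using insert by simp
qed

text \<open>On a set of finite measure constants are integrable, and \<open>\<bar>y\<bar> \<le> 1 + \<bar>y\<bar> powr r\<close> for
  \<open>r \<ge> 1\<close>.\<close>

lemma Lebesgue_space_imp_integrable:
  assumes "1 \<le> \<theta>" and "bounded U" "open U" and u: "u \<in> Lebesgue_space \<theta> U"
  shows "integrable (lebesgue_on U) u"
proof -
  have meas [measurable]: "u \<in> borel_measurable (lebesgue_on U)"
    using u by (auto simp: Lebesgue_space_def)
  have one: "integrable (lebesgue_on U) (\<lambda>x. c)" for c :: real
    using assms by (intro finite_measure.integrable_const finite_measure_lebesgue_on)
      (auto simp: lmeasurable_open)
  show ?thesis
  proof (cases "\<theta> = \<infinity>")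
    case True
    then obtain C where "AE x in lebesgue_on U. \<bar>u x\<bar> \<le> C"
      using u by (auto simp: Lebesgue_space_def)
    then show ?thesis
      by (intro Bochner_Integration.integrable_bound[OF one[of C]]) auto
  next
    case False
    define r where "r = enn2real \<theta>"
    have "1 \<le> r"
      using enn2real_mono[OF assms(1)] False by (simp add: r_def top.not_eq_extremum)
    have int: "integrable (lebesgue_on U) (\<lambda>x. 1 + \<bar>u x\<bar> powr r)"
      using u False one by (auto simp: Lebesgue_space_def r_def)
    have "\<bar>y\<bar> \<le> 1 + \<bar>y\<bar> powr r" for y :: real
    proof (cases "\<bar>y\<bar> \<le> 1")
      case False
      then have "\<bar>y\<bar> powr 1 \<le> \<bar>y\<bar> powr r"
        using \<open>1 \<le> r\<close> by (intro powr_mono) auto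
      then show ?thesis by simp
    qed (simp add: add_increasing2)
    then show ?thesis
      by (intro Bochner_Integration.integrable_bound[OF int]) auto
  qed
qed

text \<open>The Bochner integral is additive only on integrable functions; each product of a summand with
  the test function is integrable because test functions are bounded.\<close>

lemma dist_of_lincomb:
  assumes "1 \<le> \<theta>" "bounded U" "open U" and v: "\<And>a. a \<in> A \<Longrightarrow> v a \<in> Lebesgue_space \<theta> U"
    and \<phi>: "test_function U \<phi>"
  shows "dist_of U (\<lambda>x. \<Sum>a\<in>A. c a * v a x) \<phi> = (\<Sum>a\<in>A. c a * dist_of U (v a) \<phi>)"
proof -
  obtain B where B: "\<And>x. \<bar>\<phi> x\<bar> \<le> B"
    using test_function_bounded[OF \<phi>] by blast
  have "continuous_on U \<phi>"
    using \<phi> unfolding test_function_def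
    by (intro continuous_on_subset[OF smooth_continuous]) auto
  then have [measurable]: "\<phi> \<in> borel_measurable (lebesgue_on U)"
    using \<open>open U\<close> by (intro continuous_imp_measurable_on_sets_lebesgue) auto
  have int: "integrable (lebesgue_on U) (\<lambda>x. v a x * \<phi> x)" if "a \<in> A" for a
  proof -
    have i: "integrable (lebesgue_on U) (v a)"
      using assms that by (intro Lebesgue_space_imp_integrable) auto
    have [measurable]: "v a \<in> borel_measurable (lebesgue_on U)"
      using i by auto
    have "\<bar>v a x * \<phi> x\<bar> \<le> \<bar>v a x * B\<bar>" for x
      using B[of x] by (simp add: abs_mult mult_left_mono)
    with i show ?thesis
      by (intro Bochner_Integration.integrable_bound[OF integrable_mult_left[OF i, of B]]) auto
  qed
  show ?thesis
    unfolding dist_of_def sum_distrib_right mult.assoc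
    by (subst Bochner_Integration.integral_sum) (auto simp: int)
qed

text \<open>The empty list, which \<^const>\<open>Sobolev\<close> treats apart, is covered by the function itself.\<close>

lemma Sobolev_derivative:
  assumes "u \<in> Sobolev Y m l \<theta> U" and "length as \<le> l" and "set as \<subseteq> {1..m}"
  obtains w where "w \<in> Lebesgue_space \<theta> U"
    "dist_eq U (foldr (\<lambda>a. dist_deriv (Y a)) as (dist_of U u)) (dist_of U w)"
proof (cases "as = []")
  case True
  then show ?thesis
    using assms(1) that[of u] by (simp add: Sobolev_def dist_eq_def)
next
  case False
  then have "1 \<le> length as"
    by (simp add: Suc_leI)
  then show ?thesis
    using assms that unfolding Sobolev_def by blast
qed

text \<open>Once all derivatives have been moved to the test function, only linearity of the pairing with a
  fixed test function is left.\<close>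

lemma Sobolev_lincomb:
  assumes \<theta>: "1 \<le> \<theta>" and U: "bounded U" "open U" and A: "finite A"
    and Y: "\<And>a. a \<in> {1..m} \<Longrightarrow> smooth (Y a)"
    and v: "\<And>a. a \<in> A \<Longrightarrow> v a \<in> Sobolev Y m l \<theta> U"
  shows "(\<lambda>x. \<Sum>a\<in>A. c a * v a x) \<in> Sobolev Y m l \<theta> U"
proof -
  have vL: "v a \<in> Lebesgue_space \<theta> U" if "a \<in> A" for a
    using v[OF that] by (simp add: Sobolev_def)
  have "\<exists>w\<in>Lebesgue_space \<theta> U. dist_eq U
      (foldr (\<lambda>a. dist_deriv (Y a)) as (dist_of U (\<lambda>x. \<Sum>a\<in>A. c a * v a x))) (dist_of U w)"
    if as: "length as \<le> l" "set as \<subseteq> {1..m}" for as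
  proof -
    have "\<forall>a\<in>A. \<exists>w. w \<in> Lebesgue_space \<theta> U \<and>
        dist_eq U (foldr (\<lambda>a. dist_deriv (Y a)) as (dist_of U (v a))) (dist_of U w)"
      using Sobolev_derivative[OF v as] by metis
    then obtain w where wL: "\<And>a. a \<in> A \<Longrightarrow> w a \<in> Lebesgue_space \<theta> U"
      and w: "\<And>a. a \<in> A \<Longrightarrow>
        dist_eq U (foldr (\<lambda>a. dist_deriv (Y a)) as (dist_of U (v a))) (dist_of U (w a))"
      by metis
    have "foldr (\<lambda>a. dist_deriv (Y a)) as (dist_of U (\<lambda>x. \<Sum>a\<in>A. c a * v a x)) \<phi> =
        dist_of U (\<lambda>x. \<Sum>a\<in>A. c a * w a x) \<phi>" if \<phi>: "test_function U \<phi>" for \<phi>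
    proof -
      let ?\<psi> = "fold (\<lambda>a. field_apply (Y a)) as \<phi>"
      have \<psi>: "test_function U ?\<psi>"
        using as Y \<phi> by (intro test_function_fold) auto
      have "foldr (\<lambda>a. dist_deriv (Y a)) as (dist_of U (\<lambda>x. \<Sum>a\<in>A. c a * v a x)) \<phi> =
          (\<Sum>a\<in>A. c a * ((- 1) ^ length as * dist_of U (v a) ?\<psi>))"
        by (simp add: foldr_dist_deriv dist_of_lincomb[OF \<theta> U vL \<psi>] sum_distrib_left mult_ac)
      also have "\<dots> = (\<Sum>a\<in>A. c a * dist_of U (w a) \<phi>)"
        using w \<phi> by (intro sum.cong) (auto simp: dist_eq_def foldr_dist_deriv)
      also have "\<dots> = dist_of U (\<lambda>x. \<Sum>a\<in>A. c a * w a x) \<phi>"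
        by (simp add: dist_of_lincomb[OF \<theta> U wL \<phi>])
      finally show ?thesis .
    qed
    then show ?thesis
      unfolding dist_eq_def by (intro bexI[OF _ Lebesgue_space_lincomb[OF \<theta> A wL, where c = c]]) simp_all
  qed
  then show ?thesis
    using Lebesgue_space_lincomb[OF \<theta> A vL] by (simp add: Sobolev_def)
qed

text \<open>The last index of the list is the derivative that hits \<open>u\<close> first; replacing it by \<open>g a\<close>
  leaves at most \<open>l\<close> derivatives, taken of a function in the space of order \<open>l\<close>.\<close>

lemma Sobolev_SucI:
  assumes u: "u \<in> Lebesgue_space \<theta> U"
    and Y: "\<And>a. a \<in> {1..m} \<Longrightarrow> smooth (Y a)"
    and g: "\<And>a. a \<in> {1..m} \<Longrightarrow> g a \<in> Sobolev Y m l \<theta> U"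
    and eq: "\<And>a. a \<in> {1..m} \<Longrightarrow> dist_eq U (dist_deriv (Y a) (dist_of U u)) (dist_of U (g a))"
  shows "u \<in> Sobolev Y m (Suc l) \<theta> U"
proof -
  have "\<exists>w\<in>Lebesgue_space \<theta> U.
      dist_eq U (foldr (\<lambda>a. dist_deriv (Y a)) as (dist_of U u)) (dist_of U w)"
    if as: "1 \<le> length as" "length as \<le> Suc l" "set as \<subseteq> {1..m}" for as
  proof -
    obtain as' a where as': "as = as' @ [a]"
      using as(1) by (cases as rule: rev_cases) auto
    then have a: "a \<in> {1..m}" and len: "length as' \<le> l" and set: "set as' \<subseteq> {1..m}"
      using as by auto
    obtain w where w: "w \<in> Lebesgue_space \<theta> U"
      "dist_eq U (foldr (\<lambda>a. dist_deriv (Y a)) as' (dist_of U (g a))) (dist_of U w)"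
      using Sobolev_derivative[OF g[OF a] len set] .
    have "foldr (\<lambda>a. dist_deriv (Y a)) as (dist_of U u) \<phi> = dist_of U w \<phi>"
      if \<phi>: "test_function U \<phi>" for \<phi>
    proof -
      let ?\<psi> = "fold (\<lambda>a. field_apply (Y a)) as' \<phi>"
      have \<psi>: "test_function U ?\<psi>"
        using set Y \<phi> by (intro test_function_fold) auto
      have "foldr (\<lambda>a. dist_deriv (Y a)) as (dist_of U u) \<phi> =
          (- 1) ^ length as' * dist_deriv (Y a) (dist_of U u) ?\<psi>"
        unfolding as' foldr_append foldr_dist_deriv[of Y as'] by simp
      also have "\<dots> = foldr (\<lambda>a. dist_deriv (Y a)) as' (dist_of U (g a)) \<phi>"
        using eq[OF a] \<psi> by (simp add: dist_eq_def foldr_dist_deriv)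
      finally show ?thesis
        using w(2) \<phi> by (simp add: dist_eq_def)
    qed
    then show ?thesis
      unfolding dist_eq_def by (intro bexI[OF _ w(1)]) simp
  qed
  then show ?thesis
    using u by (simp add: Sobolev_def)
qed

section \<open>The frame of a stratified group\<close>

text \<open>The direct-sum hypothesis speaks of tuples with one entry per layer: an element of a layer is
  the sum of the tuple whose other entries vanish.\<close>

lemma (in stratified_group) layer_left_invariant:
  assumes i: "i \<in> {1..s}" and Y: "Y \<in> V i"
  shows "Y \<in> lie_algebra mul"
proof -
  let ?F = "\<lambda>j. if j \<in> {1..s} then if j = i then Y else 0 else undefined"
  have "?F \<in> (\<Pi>\<^sub>E j\<in>{1..s}. V j)"
    using Y by (auto simp: PiE_iff extensional_def subspace_0 subspace_layer)
  moreover have "(\<Sum>j=1..s. ?F j) = Y"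
    using i by simp
  ultimately show ?thesis
    using direct_sum unfolding bij_betw_def by (metis (no_types, lifting) imageI)
qed

lemma (in stratified_group) left_translation_differentiable: "mul q differentiable (at p)"
proof -
  have "((\<lambda>(p, q). mul p q) \<circ> Pair q) differentiable (at p)"
    using smooth_differentiable[OF smooth_mul]
    by (intro differentiable_chain_at) (auto intro!: derivative_intros simp: differentiable_def)
  then show ?thesis
    by (simp add: comp_def)
qed

text \<open>Left translations carry \<open>p\<close> to any other point, and the linear map that is their differential
  carries \<open>Y p = 0\<close> to the value of \<open>Y\<close> there.\<close>

lemma (in stratified_group) left_invariant_eq_zero:
  assumes Y: "Y \<in> lie_algebra mul" and p: "Y p = 0"
  shows "Y = 0"
proof
  fix r
  let ?q = "mul r (ginv p)"
  have "frechet_derivative (mul ?q) (at p) (Y p) = Y (mul ?q p)"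
    using Y unfolding lie_algebra_def by blast
  moreover have "linear (frechet_derivative (mul ?q) (at p))"
    by (simp add: left_translation_differentiable linear_frechet_derivative)
  moreover have "mul ?q p = r"
    by (simp only: assoc left_inverse right_neutral)
  ultimately show "Y r = 0 r"
    using p by (simp add: linear_0)
qed

text \<open>The sum of the \<open>Y i\<close> is left-invariant and vanishes at \<open>p\<close>, hence everywhere; the Lie algebra
  is the direct sum of its layers, so every summand is zero as a field.\<close>

lemma (in stratified_group) layers_independent_at:
  assumes Y: "\<And>i. i \<in> {1..s} \<Longrightarrow> Y i \<in> V i" and p: "(\<Sum>i=1..s. Y i p) = 0" and j: "j \<in> {1..s}"
  shows "Y j = 0"
proof -
  let ?\<Sigma> = "\<lambda>Y. \<Sum>i=1..s. Y i" and ?P = "\<Pi>\<^sub>E i\<in>{1..s}. V i"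
  have mem: "restrict Y {1..s} \<in> ?P" "(\<lambda>i\<in>{1..s}. 0) \<in> ?P"
    using Y by (auto simp: subspace_0 subspace_layer)
  have "?\<Sigma> (restrict Y {1..s}) = 0"
  proof (rule left_invariant_eq_zero)
    show "?\<Sigma> (restrict Y {1..s}) \<in> lie_algebra mul"
      using direct_sum mem(1) unfolding bij_betw_def by blast
    have "(\<Sum>i\<in>I. Y i) p = (\<Sum>i\<in>I. Y i p)" for I
      by (induction I rule: infinite_finite_induct) auto
    then show "?\<Sigma> (restrict Y {1..s}) p = 0"
      using p by simp
  qed
  moreover have "?\<Sigma> (\<lambda>i\<in>{1..s}. 0) = 0"
    by simp
  ultimately have "restrict Y {1..s} = (\<lambda>i\<in>{1..s}. 0)"
    using direct_sum mem unfolding bij_betw_def inj_on_def by metis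
  then show ?thesis
    using j by (metis restrict_apply')
qed

text \<open>The stratification is stated with the horizontal field as the left argument of the bracket;
  antisymmetry moves it to the right, where \<open>[b, Z]\<close> has it.\<close>

lemma (in stratified_group) lie_bracket_layer:
  assumes i: "i \<in> {1..s}" and Y: "Y \<in> V i" and Z: "Z \<in> V 1"
  shows "i < s \<Longrightarrow> lie_bracket Y Z \<in> V (Suc i)" and "i = s \<Longrightarrow> lie_bracket Y Z = 0"
proof -
  have anti: "lie_bracket Y Z = - lie_bracket Z Y"
    by (simp add: lie_bracket_def fun_eq_iff)
  show "lie_bracket Y Z = 0" if "i = s"
    using bracket_top Y Z that anti by simp
  show "lie_bracket Y Z \<in> V (Suc i)" if "i < s"
  proof -
    have "lie_bracket Z Y \<in> V (Suc i)"
      using bracket_layer[of i] i that Y Z by (auto intro: span_base)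
    then show ?thesis
      unfolding anti using subspace_neg subspace_layer[of "Suc i"] that by auto
  qed
qed

lemma (in graded_coordinates) frame_in_layer:
  "i \<in> {1..s} \<Longrightarrow> \<alpha> \<in> {1..dim (V i)} \<Longrightarrow> X i \<alpha> \<in> V i"
  using frame_span span_superset by (metis imageI subsetD)

lemma (in graded_coordinates) frame_coefficients:
  assumes i: "i \<in> {1..s}" and Y: "Y \<in> V i"
  obtains c where "Y = (\<Sum>\<alpha>=1..dim (V i). c \<alpha> *\<^sub>R X i \<alpha>)"
proof -
  have "Y \<in> span (X i ` {1..dim (V i)})"
    using frame_span i Y by simp
  then obtain d where "Y = (\<Sum>x\<in>X i ` {1..dim (V i)}. d x *\<^sub>R x)"
    by (auto simp: span_finite)
  then have "Y = (\<Sum>\<alpha>=1..dim (V i). d (X i \<alpha>) *\<^sub>R X i \<alpha>)"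
    using frame_inj[OF i] by (simp add: sum.reindex)
  then show ?thesis by (rule that)
qed

lemma (in graded_coordinates) frame_coefficients_unique:
  assumes i: "i \<in> {1..s}" and eq: "(\<Sum>\<alpha>=1..dim (V i). c \<alpha> *\<^sub>R X i \<alpha>) = 0" and \<alpha>: "\<alpha> \<in> {1..dim (V i)}"
  shows "c \<alpha> = 0"
proof -
  let ?h = "the_inv_into {1..dim (V i)} (X i)"
  have "(\<Sum>x\<in>X i ` {1..dim (V i)}. c (?h x) *\<^sub>R x) = 0"
    using frame_inj[OF i] eq by (simp add: sum.reindex the_inv_into_f_f)
  then have "c (?h (X i \<alpha>)) = 0"
    using frame_independent[OF i] \<alpha> by (intro independentD[of _ _ "\<lambda>x. c (?h x)"]) auto
  then show ?thesis
    using frame_inj[OF i] \<alpha> by (simp add: the_inv_into_f_f)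
qed

text \<open>At a fixed point \<open>p\<close> the values \<open>b i \<alpha>\<close> and \<open>w i \<alpha>\<close> are numbers, so that the horizontality
  condition is a linear relation at \<open>p\<close> between left-invariant fields, one from each layer. All of
  these fields vanish; the one in layer \<open>i + 1\<close> yields the formula.\<close>

lemma (in graded_coordinates) horizontal_bracket_coefficients:
  assumes i: "i \<in> {1..<s}" and Z: "Z \<in> V 1"
    and c: "\<And>\<alpha>. \<alpha> \<in> {1..dim (V i)} \<Longrightarrow>
      lie_bracket (X i \<alpha>) Z = (\<Sum>\<gamma>=1..dim (V (Suc i)). c \<alpha> \<gamma> *\<^sub>R X (Suc i) \<gamma>)"
    and hor: "(\<Sum>i=1..s. \<Sum>\<alpha>=1..dim (V i). b i \<alpha> *\<^sub>R lie_bracket (X i \<alpha>) Z p)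
      - (\<Sum>i=1..s. \<Sum>\<alpha>=1..dim (V i). w i \<alpha> *\<^sub>R X i \<alpha> p) \<in> horizontal V p"
    and \<gamma>: "\<gamma> \<in> {1..dim (V (Suc i))}"
  shows "w (Suc i) \<gamma> = (\<Sum>\<alpha>=1..dim (V i). c \<alpha> \<gamma> * b i \<alpha>)"
proof -
  obtain H where H: "H \<in> V 1" and Hp: "(\<Sum>i=1..s. \<Sum>\<alpha>=1..dim (V i). b i \<alpha> *\<^sub>R lie_bracket (X i \<alpha>) Z p)
      - (\<Sum>i=1..s. \<Sum>\<alpha>=1..dim (V i). w i \<alpha> *\<^sub>R X i \<alpha> p) = H p"
    using hor by (auto simp: horizontal_def)
  define B where "B j = (\<Sum>\<alpha>=1..dim (V j). b j \<alpha> *\<^sub>R lie_bracket (X j \<alpha>) Z)" for j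
  define W where "W j = (\<Sum>\<alpha>=1..dim (V j). w j \<alpha> *\<^sub>R X j \<alpha>)" for j
  \<comment> \<open>The component of the relation in layer \<open>j\<close>: bracketing with \<open>Z\<close> raises the layer by one, which
    shifts the index of \<open>B\<close>, and the horizontal remainder \<open>H\<close> belongs to layer 1.\<close>
  define Y where "Y j = (if j = 1 then - H else B (j - 1)) - W j" for j
  have apply_sum: "(\<Sum>i\<in>I. F i) q = (\<Sum>i\<in>I. F i q)" for I :: "nat set" and F :: "nat \<Rightarrow> 'a \<Rightarrow> 'a" and q
    by (induction I rule: infinite_finite_induct) auto
  have Bs: "B s = 0"
    unfolding B_def using lie_bracket_layer(2)[OF _ frame_in_layer Z] step_pos
    by (intro sum.neutral) auto
  have BV: "B j \<in> V (Suc j)" if "j \<in> {1..<s}" for j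
    unfolding B_def using that lie_bracket_layer(1)[OF _ frame_in_layer Z] subspace_layer[of "Suc j"]
    by (intro subspace_sum subspace_scale) auto
  have WV: "W j \<in> V j" if "j \<in> {1..s}" for j
    unfolding W_def using that frame_in_layer subspace_layer
    by (intro subspace_sum subspace_scale) auto
  have "Y j \<in> V j" if j: "j \<in> {1..s}" for j
  proof -
    have "(if j = 1 then - H else B (j - 1)) \<in> V j"
    proof (cases "j = 1")
      case True
      then show ?thesis
        using H subspace_neg[OF subspace_layer[OF j]] by simp
    next
      case False
      then have "j - 1 \<in> {1..<s}" "Suc (j - 1) = j"
        using j by auto
      then show ?thesis
        using BV[of "j - 1"] False by simp
    qed
    then show ?thesis
      unfolding Y_def using subspace_diff[OF subspace_layer[OF j]] WV[OF j] by blast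
  qed
  moreover have "(\<Sum>j=1..s. Y j p) = 0"
  proof -
    have s: "{1..s} = insert 1 {Suc 1..<Suc s}" "{1..s} = insert s {1..<s}"
      using step_pos by auto
    have "(\<Sum>j=1..s. (if j = 1 then - H else B (j - 1)) p) = - H p + (\<Sum>j=Suc 1..<Suc s. B (j - 1) p)"
      unfolding s(1) by (subst sum.insert) (auto intro: sum.cong)
    also have "(\<Sum>j=Suc 1..<Suc s. B (j - 1) p) = (\<Sum>j=1..<s. B j p)"
      by (subst sum.shift_bounds_Suc_ivl) simp
    also have "\<dots> = (\<Sum>j=1..s. B j p)"
      unfolding s(2) by (simp add: Bs)
    finally have "(\<Sum>j=1..s. Y j p) = - H p + (\<Sum>j=1..s. B j p) - (\<Sum>j=1..s. W j p)"
      by (simp add: Y_def sum_subtractf)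
    also have "\<dots> = 0"
      using Hp by (simp add: B_def W_def apply_sum scaleR_fun_def algebra_simps)
    finally show ?thesis .
  qed
  moreover have Suc: "Suc i \<in> {1..s}"
    using i by auto
  ultimately have "Y (Suc i) = 0"
    using layers_independent_at by blast
  then have "B i - W (Suc i) = 0"
    using i by (simp add: Y_def)
  moreover have "B i = (\<Sum>\<gamma>=1..dim (V (Suc i)). (\<Sum>\<alpha>=1..dim (V i). c \<alpha> \<gamma> * b i \<alpha>) *\<^sub>R X (Suc i) \<gamma>)"
  proof -
    have "B i = (\<Sum>\<alpha>=1..dim (V i). \<Sum>\<gamma>=1..dim (V (Suc i)). (c \<alpha> \<gamma> * b i \<alpha>) *\<^sub>R X (Suc i) \<gamma>)"
      unfolding B_def by (intro sum.cong) (auto simp: c scaleR_sum_right mult.commute)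
    then show ?thesis
      by (subst (asm) sum.swap) (simp only: scaleR_sum_left)
  qed
  ultimately have "(\<Sum>\<gamma>=1..dim (V (Suc i)).
      ((\<Sum>\<alpha>=1..dim (V i). c \<alpha> \<gamma> * b i \<alpha>) - w (Suc i) \<gamma>) *\<^sub>R X (Suc i) \<gamma>) = 0"
    by (simp add: W_def scaleR_diff_left sum_subtractf)
  then show ?thesis
    using frame_coefficients_unique[OF Suc _ \<gamma>] by fastforce
qed

section \<open>Horizontal derivatives of the coefficients\<close>

text \<open>A test function on \<open>U\<close> is one on the whole space, and its pairings with functions do not see
  the complement of \<open>U\<close>. Hence a global weak derivative restricts to \<open>U\<close>, where it can be replaced
  by any measurable function equal to it almost everywhere.\<close>

lemma weak_deriv_dist_eq_on:
  assumes wd: "weak_deriv UNIV Z u w" and Z: "smooth Z" and U: "open U" "bounded U"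
    and ae: "AE x in lebesgue. w x = g x" and g: "g \<in> borel_measurable (lebesgue_on U)"
  shows "dist_eq U (dist_deriv Z (dist_of U u)) (dist_of U g)"
  unfolding dist_eq_def
proof (intro allI impI)
  fix \<phi> assume \<phi>: "test_function U \<phi>"
  have "compact (closure U)"
    using U by simp
  then have "w \<in> borel_measurable (lebesgue_on U)"
    using wd U by (auto simp: weak_deriv_def loc_def Lebesgue_space_def)
  moreover have "continuous_on U \<phi>"
    using \<phi> unfolding test_function_def
    by (intro continuous_on_subset[OF smooth_continuous]) auto
  then have "\<phi> \<in> borel_measurable (lebesgue_on U)"
    using U by (intro continuous_imp_measurable_on_sets_lebesgue) auto
  moreover have "AE x in lebesgue_on U. w x = g x"
    using ae U by (subst AE_restrict_space_iff) auto
  ultimately have "dist_of U w \<phi> = dist_of U g \<phi>"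
    unfolding dist_of_def using g by (intro integral_cong_AE) auto
  moreover have "dist_deriv Z (dist_of UNIV u) \<phi> = dist_of UNIV w \<phi>"
    using wd test_function_mono[OF \<phi>] by (auto simp: weak_deriv_def dist_eq_def)
  ultimately show "dist_deriv Z (dist_of U u) \<phi> = dist_of U g \<phi>"
    using dist_of_restrict[OF U(1)] \<phi> test_function_field_apply[OF Z \<phi>]
    by (simp add: dist_deriv_def)
qed

lemma (in graded_coordinates) horizontal_derivative_lincomb:
  assumes b: "bracket_horizontal s V X b" and i: "i \<in> {1..<s}" and Z: "Z \<in> V 1"
  obtains c w where
    "\<And>\<gamma>. \<gamma> \<in> {1..dim (V (Suc i))} \<Longrightarrow> weak_deriv UNIV Z (b (Suc i) \<gamma>) (w \<gamma>)"
    "\<And>\<gamma>. \<gamma> \<in> {1..dim (V (Suc i))} \<Longrightarrow>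
      AE p in lebesgue. w \<gamma> p = (\<Sum>\<alpha>=1..dim (V i). c \<alpha> \<gamma> * b i \<alpha> p)"
proof -
  obtain w where wd: "\<And>i \<alpha>. i \<in> {1..s} \<Longrightarrow> \<alpha> \<in> {1..dim (V i)} \<Longrightarrow> weak_deriv UNIV Z (b i \<alpha>) (w i \<alpha>)"
    and hor: "AE p in lebesgue.
        (\<Sum>i=1..s. \<Sum>\<alpha>=1..dim (V i). b i \<alpha> p *\<^sub>R lie_bracket (X i \<alpha>) Z p)
        - (\<Sum>i=1..s. \<Sum>\<alpha>=1..dim (V i). w i \<alpha> p *\<^sub>R X i \<alpha> p) \<in> horizontal V p"
    using b Z unfolding bracket_horizontal_def by blast
  have "\<exists>c. lie_bracket (X i \<alpha>) Z = (\<Sum>\<gamma>=1..dim (V (Suc i)). c \<gamma> *\<^sub>R X (Suc i) \<gamma>)"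
    if "\<alpha> \<in> {1..dim (V i)}" for \<alpha>
  proof -
    have "lie_bracket (X i \<alpha>) Z \<in> V (Suc i)"
      using lie_bracket_layer(1)[OF _ frame_in_layer Z] i that by auto
    moreover have "Suc i \<in> {1..s}"
      using i by auto
    ultimately show ?thesis
      by (blast elim: frame_coefficients)
  qed
  then obtain c where c: "\<And>\<alpha>. \<alpha> \<in> {1..dim (V i)} \<Longrightarrow>
      lie_bracket (X i \<alpha>) Z = (\<Sum>\<gamma>=1..dim (V (Suc i)). c \<alpha> \<gamma> *\<^sub>R X (Suc i) \<gamma>)"
    by metis
  have "AE p in lebesgue. w (Suc i) \<gamma> p = (\<Sum>\<alpha>=1..dim (V i). c \<alpha> \<gamma> * b i \<alpha> p)"
    if \<gamma>: "\<gamma> \<in> {1..dim (V (Suc i))}" for \<gamma>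
    using hor
  proof eventually_elim
    case (elim p)
    show ?case
      using horizontal_bracket_coefficients[OF i Z c elim \<gamma>] .
  qed
  moreover have "Suc i \<in> {1..s}"
    using i by auto
  ultimately show ?thesis
    using that[of "w (Suc i)" c] wd by blast
qed

theorem proposition4p1:
  fixes mul :: "'a::euclidean_space \<Rightarrow> 'a \<Rightarrow> 'a" and ginv :: "'a \<Rightarrow> 'a"
    and s :: nat and V :: "nat \<Rightarrow> ('a \<Rightarrow> 'a) set"
    and X :: "nat \<Rightarrow> nat \<Rightarrow> 'a \<Rightarrow> 'a" and E :: "nat \<Rightarrow> nat \<Rightarrow> 'a"
    and \<theta> :: ennreal and b :: "nat \<Rightarrow> nat \<Rightarrow> 'a \<Rightarrow> real"
  assumes "graded_coordinates mul ginv s V X E"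
    and "1 \<le> \<theta>"
    and "\<And>i \<alpha>. i \<in> {1..s} \<Longrightarrow> \<alpha> \<in> {1..dim (V i)} \<Longrightarrow>
           b i \<alpha> \<in> loc (Sobolev (X 1) (dim (V 1)) 1 \<theta>) UNIV"
    and "bracket_horizontal s V X b"
  shows "\<forall>i\<in>{1..s}. \<forall>\<alpha>\<in>{1..dim (V i)}. b i \<alpha> \<in> loc (Sobolev (X 1) (dim (V 1)) i \<theta>) UNIV"
proof -
  interpret graded_coordinates mul ginv s V X E
    by (rule assms(1))
  let ?m = "dim (V 1)"
  have XV: "X 1 \<beta> \<in> V 1" if "\<beta> \<in> {1..?m}" for \<beta>
    using frame_in_layer[of 1] step_pos that by simp
  have smooth_X: "smooth (X 1 \<beta>)" if "\<beta> \<in> {1..?m}" for \<beta>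
    using layer_left_invariant[of 1] XV[OF that] step_pos by (simp add: lie_algebra_def)
  have "b i \<alpha> \<in> Sobolev (X 1) ?m i \<theta> U"
    if U: "open U" "bounded U" and "1 \<le> i" "i \<le> s" "\<alpha> \<in> {1..dim (V i)}" for U i \<alpha>
    using that(3-)
  proof (induction i arbitrary: \<alpha> rule: nat_induct_at_least)
    case base
    then show ?case
      using assms(3)[of 1 \<alpha>] U by (simp add: loc_def)
  next
    case (Suc i)
    have i: "i \<in> {1..<s}"
      using Suc by auto
    have L: "b (Suc i) \<alpha> \<in> Lebesgue_space \<theta> U"
      using assms(3)[of "Suc i" \<alpha>] Suc.prems U by (simp add: loc_def Sobolev_def)
    have "\<exists>g. g \<in> Sobolev (X 1) ?m i \<theta> U \<and>
        dist_eq U (dist_deriv (X 1 \<beta>) (dist_of U (b (Suc i) \<alpha>))) (dist_of U g)"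
      if \<beta>: "\<beta> \<in> {1..?m}" for \<beta>
    proof -
      obtain c w where wd: "weak_deriv UNIV (X 1 \<beta>) (b (Suc i) \<alpha>) (w \<alpha>)"
        and ae: "AE p in lebesgue. w \<alpha> p = (\<Sum>\<delta>=1..dim (V i). c \<delta> \<alpha> * b i \<delta> p)"
        using horizontal_derivative_lincomb[OF assms(4) i XV[OF \<beta>]] Suc.prems(2) by metis
      define g where "g = (\<lambda>p. \<Sum>\<delta>=1..dim (V i). c \<delta> \<alpha> * b i \<delta> p)"
      have g: "g \<in> Sobolev (X 1) ?m i \<theta> U"
        unfolding g_def using Suc.IH Suc.prems(1) U smooth_X assms(2)
        by (intro Sobolev_lincomb) auto
      then have "g \<in> borel_measurable (lebesgue_on U)"
        by (simp add: Sobolev_def Lebesgue_space_def)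
      moreover have "AE p in lebesgue. w \<alpha> p = g p"
        using ae by (simp add: g_def)
      ultimately show ?thesis
        using weak_deriv_dist_eq_on[OF wd smooth_X[OF \<beta>] U] g by auto
    qed
    then obtain g where "\<And>\<beta>. \<beta> \<in> {1..?m} \<Longrightarrow> g \<beta> \<in> Sobolev (X 1) ?m i \<theta> U \<and>
        dist_eq U (dist_deriv (X 1 \<beta>) (dist_of U (b (Suc i) \<alpha>))) (dist_of U (g \<beta>))"
      by metis
    then show ?case
      using smooth_X by (intro Sobolev_SucI[OF L, where Y = "X 1" and g = g]) auto
  qed
  then show ?thesis
    by (auto simp: loc_def)
qed

end
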